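(* For all real $a,b>0$ with $a\neq b$, writing $A,G,L,I,X$ for $A(a,b),G(a,b),L(a,b),I(a,b),X(a,b)$ and $M_q=M_q(a,b)$, one has $$\frac{A+G}{e}<X<M_q<\frac{L+I}{2}<\frac{A+G}{2},$$ where $q=\dfrac{\log 2}{1+\log 2}\approx 0.4094$ is the best possible constant.
   Context: For real $a,b>0$ with $a\neq b$: $A(a,b)=\frac{a+b}{2}$, $G(a,b)=\sqrt{ab}$, $L(a,b)=\dfrac{a-b}{\log a-\log b}$ (logarithmic mean), $I(a,b)=\dfrac1e\left(\dfrac{a^a}{b^b}\right)^{1/(a-b)}$ (identric mean), $P(a,b)=\dfrac{a-b}{2\arcsin\left(\frac{a-b}{a+b}\right)}$ (Seiffert mean), and $X(a,b)=A\,e^{G/P-1}$. For $p\in\mathbb{R}$ the power mean is $M_p(a,b)=\left(\frac{a^p+b^p}{2}\right)^{1/p}$ if $p\neq0$ and $M_0(a,b)=\sqrt{ab}$. "Best possible" means best possible on both sides: $q$ cannot be replaced by a smaller number in $X<M_q$, nor by a larger number in $M_q<(L+I)/2$, with the inequality still holding for all $a,b>0$, $a\neq b$. *)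

theory Defs
  imports Complex_Main
begin

text \<open>
  All means are meant for positive arguments. The formulas for \<open>log_mean\<close>, \<open>identric_mean\<close>,
  \<open>seiffert_mean\<close> (and hence \<open>X_mean\<close>) are the intended ones only for \<open>a \<noteq> b\<close>; on the
  diagonal they do not give the usual continuous extension.
\<close>

definition arith_mean :: "real \<Rightarrow> real \<Rightarrow> real" where
  "arith_mean a b = (a + b) / 2"

definition geom_mean :: "real \<Rightarrow> real \<Rightarrow> real" where
  "geom_mean a b = sqrt (a * b)"

definition log_mean :: "real \<Rightarrow> real \<Rightarrow> real" where
  "log_mean a b = (a - b) / (ln a - ln b)"

definition identric_mean :: "real \<Rightarrow> real \<Rightarrow> real" where
  "identric_mean a b = (1 / exp 1) * ((a powr a) / (b powr b)) powr (1 / (a - b))"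

definition seiffert_mean :: "real \<Rightarrow> real \<Rightarrow> real" where
  "seiffert_mean a b = (a - b) / (2 * arcsin ((a - b) / (a + b)))"

definition X_mean :: "real \<Rightarrow> real \<Rightarrow> real" where
  "X_mean a b = arith_mean a b * exp (geom_mean a b / seiffert_mean a b - 1)"

definition power_mean :: "real \<Rightarrow> real \<Rightarrow> real \<Rightarrow> real" where
  "power_mean p a b =
     (if p = 0 then sqrt (a * b) else ((a powr p + b powr p) / 2) powr (1 / p))"

end

(* By homogeneity and symmetry take a = e^t, b = e^-t with t > 0; then A = cosh t, G = 1,
   L = sinh t / t, I = exp (t coth t - 1), X = cosh t exp (arctan (sinh t) / sinh t - 1) and
   M_p = cosh (p t)^(1/p). The value of q is the one for which X, M_q and (L + I)/2 all grow
   like e^t / (2 e), so every other exponent fails for large t.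

   X < M_q: the difference of logarithms tends to 0 at both ends, and differentiating it twice,
   with positive factors removed in between, leaves a combination of sinh 2t, sinh 2(1-q)t and
   sinh 2qt that is positive first and negative afterwards. This sign pattern passes to
   antiderivatives vanishing at 0.

   M_q < (L + I)/2: for t <= 7/4 even M_q < sqrt (L I), by Taylor bounds; for t >= 7/4 the
   inequality follows from I > e^(t - 1) and Bernoulli's inequality.

   L + I < A + G: the derivative of ln (A + G - L) - ln I has the sign of
   L^2 + L - (1 + cosh t), a hyperbolic form of Wilker's inequality. *)

theory Submission
  imports Defs "HOL-Analysis.Harmonic_Numbers" "HOL-Real_Asymp.Real_Asymp"
begin

section \<open>Passing sign information from derivatives to functions on the positive axis\<close>

lemma pos_if_deriv_pos_at_right_0:
  fixes f f' :: "real \<Rightarrow> real"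
  assumes lim: "(f \<longlongrightarrow> 0) (at_right 0)" and x: "0 < x"
    and deriv: "\<And>y. 0 < y \<Longrightarrow> y \<le> x \<Longrightarrow> (f has_real_derivative f' y) (at y)"
    and pos: "\<And>y. 0 < y \<Longrightarrow> y < x \<Longrightarrow> 0 < f' y"
  shows "0 < f x"
proof -
  have less: "f u < f v" if "0 < u" "u < v" "v \<le> x" for u v
  proof (rule DERIV_pos_imp_increasing_open[OF \<open>u < v\<close>])
    show "\<exists>d. (f has_real_derivative d) (at y) \<and> 0 < d" if "u < y" "y < v" for y
      using deriv[of y] pos[of y] that \<open>0 < u\<close> \<open>v \<le> x\<close> by auto
    show "continuous_on {u..v} f"
      using that by (intro continuous_at_imp_continuous_on ballI DERIV_isCont[OF deriv]) auto
  qed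
  \<comment> \<open>The limit only yields \<open>0 \<le> f (x/2)\<close>; the intermediate point
    \<open>x/2\<close> makes the final inequality strict.\<close>
  have "eventually (\<lambda>y. f y \<le> f (x/2)) (at_right 0)"
    unfolding eventually_at_right_field
    using less[of _ "x/2"] x by (intro exI[of _ "x/2"]) (auto intro!: less_imp_le)
  then have "0 \<le> f (x/2)"
    using tendsto_upperbound[OF lim] by simp
  also have "f (x/2) < f x" using x by (intro less) auto
  finally show ?thesis .
qed

text \<open>The sign pattern ``positive, then negative'', either phase possibly missing.\<close>

definition stays_negative :: "(real \<Rightarrow> real) \<Rightarrow> bool" where
  "stays_negative f \<longleftrightarrow> (\<forall>x y. 0 < x \<longrightarrow> x < y \<longrightarrow> f x \<le> 0 \<longrightarrow> f y < 0)"

text \<open>If \<open>p * g\<close> were positive on all of (0, x), then \<open>f x\<close> would be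
  positive, since \<open>f\<close> starts from limit 0. So \<open>g\<close> is nonpositive somewhere
  before \<open>x\<close>, hence negative afterwards. The positive factor \<open>p\<close> allows a
  derivative to be rescaled before it is differentiated again.\<close>

lemma decreasing_if_deriv_stays_negative:
  fixes f g p :: "real \<Rightarrow> real"
  assumes lim: "(f \<longlongrightarrow> 0) (at_right 0)"
    and deriv: "\<And>y. 0 < y \<Longrightarrow> (f has_real_derivative p y * g y) (at y)"
    and p: "\<And>y. 0 < y \<Longrightarrow> 0 < p y" and g: "stays_negative g"
    and x: "0 < x" "f x \<le> 0" and uv: "x \<le> u" "u < v"
  shows "f v < f u"
proof -
  have "\<exists>z. 0 < z \<and> z < x \<and> p z * g z \<le> 0"
  proof (rule ccontr)
    assume "\<not> ?thesis"
    then have "0 < f x"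
      by (intro pos_if_deriv_pos_at_right_0[OF lim x(1), of "\<lambda>y. p y * g y"] deriv) (auto simp: not_le)
    with x show False by simp
  qed
  then obtain z where z: "0 < z" "z < x" "p z * g z \<le> 0" by blast
  from z p[of z] have "g z \<le> 0" by (simp add: mult_le_0_iff)
  with g z have neg: "g y < 0" if "z < y" for y
    using that unfolding stays_negative_def by blast
  show ?thesis
  proof (rule DERIV_neg_imp_decreasing[OF uv(2)])
    fix y assume "u \<le> y"
    then have "z < y" "0 < y" using z uv by auto
    then show "\<exists>d. (f has_real_derivative d) (at y) \<and> d < 0"
      using deriv[of y] p[of y] neg[of y] by (auto simp: mult_less_0_iff)
  qed
qed

lemma stays_negative_antiderivative:
  fixes f g p :: "real \<Rightarrow> real"
  assumes "(f \<longlongrightarrow> 0) (at_right 0)"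
    and "\<And>y. 0 < y \<Longrightarrow> (f has_real_derivative p y * g y) (at y)"
    and "\<And>y. 0 < y \<Longrightarrow> 0 < p y" and "stays_negative g"
  shows "stays_negative f"
  unfolding stays_negative_def
proof (intro allI impI)
  fix x y :: real assume "0 < x" "x < y" "f x \<le> 0"
  then show "f y < 0"
    using decreasing_if_deriv_stays_negative[OF assms \<open>0 < x\<close> \<open>f x \<le> 0\<close>, of x y] by simp
qed

text \<open>A nonpositive value at \<open>x\<close> would start a strict decrease, keeping
  \<open>f\<close> below the negative number \<open>f (x + 1)\<close> and so away from its limit 0
  at infinity.\<close>

lemma pos_if_deriv_stays_negative:
  fixes f g p :: "real \<Rightarrow> real"
  assumes "(f \<longlongrightarrow> 0) (at_right 0)"
    and "\<And>y. 0 < y \<Longrightarrow> (f has_real_derivative p y * g y) (at y)"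
    and "\<And>y. 0 < y \<Longrightarrow> 0 < p y" and "stays_negative g"
    and lim: "(f \<longlongrightarrow> 0) at_top" and x: "0 < x"
  shows "0 < f x"
proof (rule ccontr)
  assume "\<not> 0 < f x"
  then have fx: "f x \<le> 0" by simp
  note less = decreasing_if_deriv_stays_negative[OF assms(1-4) x fx]
  have "eventually (\<lambda>y. f y \<le> f (x + 1)) at_top"
    using eventually_gt_at_top[of "x + 1"]
    by eventually_elim (auto intro!: less_imp_le less)
  then have "0 \<le> f (x + 1)"
    using tendsto_upperbound[OF lim] by simp
  with less[of x "x + 1"] fx show False by simp
qed

section \<open>The inequality X < M_q\<close>

lemma sinh_mult_le:
  fixes l y :: real
  assumes "0 \<le> l" "l \<le> 1" "0 \<le> y"
  shows "sinh (l * y) \<le> l * sinh y"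
proof -
  \<comment> \<open>This is convexity of sinh on the nonnegative axis combined with sinh 0 = 0, in
    the form of a monotone difference.\<close>
  have "(\<lambda>y. l * sinh y - sinh (l * y)) 0 \<le> (\<lambda>y. l * sinh y - sinh (l * y)) y"
  proof (rule DERIV_nonneg_imp_nondecreasing[OF \<open>0 \<le> y\<close>])
    fix x :: real assume x: "0 \<le> x"
    have "((\<lambda>y. l * sinh y - sinh (l * y)) has_real_derivative l * (cosh x - cosh (l * x))) (at x)"
      by (auto intro!: derivative_eq_intros simp: algebra_simps)
    moreover have "cosh (l * x) \<le> cosh x"
      using assms x by (intro cosh_real_nonneg_le_iff[THEN iffD2]) (auto intro: mult_left_le_one_le)
    ultimately show "\<exists>d. ((\<lambda>y. l * sinh y - sinh (l * y)) has_real_derivative d) (at x) \<and> 0 \<le> d"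
      using assms by force
  qed
  then show ?thesis by simp
qed

text \<open>\<open>k1\<close> and \<open>k2\<close> are the first and second derivatives. As
  \<open>k2\<close> is negative, \<open>k1\<close> decreases strictly and so has the sign pattern;
  the combination vanishes at 0 and inherits it.\<close>

lemma sinh_combination_stays_negative:
  fixes q :: real
  assumes q: "2/5 \<le> q" "q \<le> 7/17"
  shows "stays_negative (\<lambda>t. (2*q - 1) * sinh (2*t) - sinh (2*(1-q)*t) + 3 * sinh (2*q*t))"
proof -
  define k1 where "k1 t = 2*((2*q - 1) * cosh (2*t) - (1-q)*cosh (2*(1-q)*t) + 3*q * cosh (2*q*t))" for t
  define k2 where "k2 t = 4*((2*q - 1) * sinh (2*t) - (1-q)^2* sinh (2*(1-q)*t) + 3*q^2 * sinh (2*q*t))" for t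
  have k2: "k2 t < 0" if t: "0 < t" for t
  proof -
    have 1: "sinh (2*q*t) \<le> q * sinh (2*t)"
      using sinh_mult_le[of q "2*t"] q t by (simp add: mult_ac)
    \<comment> \<open>The middle term of \<open>k2\<close> is traded for sinh 2qt, which is possible
      because q/(1-q) \<le> 1.\<close>
    have "sinh (q/(1-q) * (2*(1-q)*t)) \<le> q/(1-q) * sinh (2*(1-q)*t)"
      using q t by (intro sinh_mult_le) (auto simp: field_simps)
    moreover have "q/(1-q) * (2*(1-q)*t) = 2*q*t" using q by (simp add: field_simps)
    ultimately have "sinh (2*q*t) \<le> q/(1-q) * sinh (2*(1-q)*t)" by simp
    then have "(1-q) * sinh (2*q*t) \<le> q * sinh (2*(1-q)*t)"
      using q by (simp add: pos_le_divide_eq mult_ac)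
    then have "(1-q)^2 * ((1-q) * sinh (2*q*t)) \<le> (1-q)^2 * (q * sinh (2*(1-q)*t))"
      by (intro mult_left_mono) auto
    moreover have "q * (k2 t / 4)
        = q*(2*q - 1) * sinh (2*t) - (1-q)^2 * (q * sinh (2*(1-q)*t)) + 3*q^3 * sinh (2*q*t)"
      unfolding k2_def by (simp add: distrib_left right_diff_distrib power2_eq_square power3_eq_cube)
    moreover have "(3*q^3 - (1-q)^3) * sinh (2*q*t)
        = 3*q^3 * sinh (2*q*t) - (1-q)^2 * ((1-q) * sinh (2*q*t))"
      by algebra
    ultimately have "q * (k2 t / 4) \<le> q*(2*q - 1) * sinh (2*t) + (3*q^3 - (1-q)^3) * sinh (2*q*t)"
      by linarith
    \<comment> \<open>At q = 7/17 the coefficient is only 29/4913. The bound 1/10 suffices: once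
      sinh 2qt is replaced by q sinh 2t, what remains is 2q - 1 + 1/10 < 0.\<close>
    also have "(3*q^3 - (1-q)^3) * sinh (2*q*t) \<le> (1/10) * sinh (2*q*t)"
    proof (intro mult_right_mono)
      have "q^3 \<le> (7/17)^3" using q by (intro power_mono) auto
      moreover have "(10/17)^3 \<le> (1-q)^3" using q by (intro power_mono) auto
      ultimately show "3*q^3 - (1-q)^3 \<le> 1/10" by (simp add: power3_eq_cube)
    qed (use q t in auto)
    also have "\<dots> \<le> (1/10) * (q * sinh (2*t))" using 1 by simp
    finally have "q * (k2 t / 4) \<le> q * ((2*q - 9/10) * sinh (2*t))"
      by (simp add: algebra_simps)
    then have "k2 t / 4 \<le> (2*q - 9/10) * sinh (2*t)"
      using q by (subst (asm) mult_le_cancel_left_pos) auto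
    also have "\<dots> < 0" using q t by (intro mult_neg_pos) auto
    finally show ?thesis by simp
  qed
  have "stays_negative k1"
    unfolding stays_negative_def
  proof (intro allI impI)
    fix x y :: real assume x: "0 < x" "x < y" "k1 x \<le> 0"
    have "k1 y < k1 x"
    proof (rule DERIV_neg_imp_decreasing[OF x(2)])
      fix z assume "x \<le> z"
      then have "k2 z < 0" using k2 x by simp
      moreover have "(k1 has_real_derivative k2 z) (at z)"
        unfolding k1_def k2_def
        by (auto intro!: derivative_eq_intros simp: algebra_simps power2_eq_square)
      ultimately show "\<exists>d. (k1 has_real_derivative d) (at z) \<and> d < 0" by blast
    qed
    with x show "k1 y < 0" by simp
  qed
  show ?thesis
  proof (rule stays_negative_antiderivative[where p = "\<lambda>_. 1" and g = k1])
    show "((\<lambda>t. (2*q - 1) * sinh (2*t) - sinh (2*(1-q)*t) + 3 * sinh (2*q*t)) \<longlongrightarrow> 0) (at_right 0)"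
      by (auto intro!: tendsto_eq_intros)
    show "((\<lambda>t. (2*q - 1) * sinh (2*t) - sinh (2*(1-q)*t) + 3 * sinh (2*q*t))
            has_real_derivative 1 * k1 y) (at y)" for y
      unfolding k1_def by (auto intro!: derivative_eq_intros simp: algebra_simps)
  qed (use \<open>stays_negative k1\<close> in auto)
qed

text \<open>For large t, ln (cosh (r t)) / r behaves like t - (ln 2)/r and ln (cosh t) like t - ln
  2. The limit is -1 exactly for r = q; this determines q and drives both optimality claims.\<close>

lemma tendsto_ln_cosh_quotient:
  fixes r :: real assumes "0 < r"
  shows "((\<lambda>t. ln (cosh (r*t)) / r - ln (cosh t)) \<longlongrightarrow> ln 2 - ln 2 / r) at_top"
  using assms by (real_asymp simp: ln_div field_simps)

text \<open>This is \<open>ln (M\<^sub>q / X)\<close> for \<open>a = e\<^sup>t\<close>, \<open>b = e\<^sup>-\<^sup>t\<close>.\<close>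

definition X_gap where
  "X_gap q t = ln (cosh (q*t)) / q - ln (cosh t) - arctan (sinh t) / sinh t + (1::real)"

text \<open>With \<open>s\<close>, \<open>c\<close>, \<open>S\<close>, \<open>C\<close> for sinh and
  cosh of t and of q t, the left side is the derivative of \<open>\<psi>\<close> in
  \<open>X_gap_pos\<close>, and the last factor on the right is the combination of hyperbolic sines
  treated above. Free variables reduce this to rational algebra modulo two quadratic
  relations.\<close>

lemma X_gap_deriv_identity:
  fixes q s c S C :: real
  assumes nz: "c \<noteq> 0" "C \<noteq> 0" and sq: "c^2 = 1 + s^2" "C^2 = 1 + S^2"
  shows "c / c^2 - (((1 - (s/c)^2) - (1 - (S/C)^2) * q) * s^2 / c
           + (s/c - S/C) * ((2 * s * c * c - s^2 * s) / c^2))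
         - (c * c^2 - s * (2 * c * s)) / (c^2)^2
       = s / (4 * c^2 * C^2) * (4 * (q * s * c - s * c * C^2 + S * C * (c^2 + 1)))"
proof -
  have 1: "1 - (s/c)^2 = 1 / c^2" "1 - (S/C)^2 = 1 / C^2"
    unfolding power_divide using nz by (simp_all add: divide_simps) (use sq in algebra)+
  \<comment> \<open>As a rewrite rule this eliminates s^2 in favour of c^2, giving both sides a
    common normal form.\<close>
  have [simp]: "s * (s * x) = (c * c - 1) * x" for x
    using sq by (simp add: power2_eq_square algebra_simps)
  show ?thesis
    unfolding 1 using nz
    by (simp add: field_simps power2_eq_square)
qed

lemma X_gap_deriv_identity':
  fixes q s c S C a :: real
  assumes nz: "s \<noteq> 0" "c \<noteq> 0" "C \<noteq> 0" "q \<noteq> 0" and sq: "c^2 = 1 + s^2"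
  shows "S * q / C / q - s / c - (c / (1 + s^2) * s - a * c) / (s * s)
       = c / s^2 * (a - (s / c - S / C) * s^2 / c - s / c^2)"
  unfolding sq[symmetric] using nz by (simp add: field_simps power2_eq_square)

lemma X_gap_pos:
  assumes q: "q = ln 2 / (1 + ln 2)" "2/5 \<le> q" "q \<le> 7/17" and t: "0 < t"
  shows "0 < X_gap q t"
proof -
  define k where "k t = (2*q - 1) * sinh (2*t) - sinh (2*(1-q)*t) + 3 * sinh (2*q*t)" for t
  \<comment> \<open>\<open>\<psi>\<close> is the derivative of \<open>X_gap q\<close> divided by
    cosh t / (sinh t)^2. The arctangent is left with a constant coefficient, so one more
    differentiation removes it.\<close>
  define \<psi> where "\<psi> t = arctan (sinh t) - (tanh t - tanh (q*t)) * (sinh t)^2 / cosh t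
                            - sinh t / (cosh t)^2" for t
  have "q > 0" using q(2) by linarith
  have k: "stays_negative k" using sinh_combination_stays_negative[OF q(2,3)] by (simp add: k_def[abs_def])
  have "stays_negative \<psi>"
  proof (rule stays_negative_antiderivative[OF _ _ _ k])
    show "(\<psi> \<longlongrightarrow> 0) (at_right 0)"
      unfolding \<psi>_def tanh_def by (auto intro!: tendsto_eq_intros)
    fix t :: real assume t: "0 < t"
    let ?s = "sinh t" and ?c = "cosh t" and ?S = "sinh (q*t)" and ?C = "cosh (q*t)"
    have "?c > 0" "?C > 0" by (auto simp: cosh_real_pos)
    then have nz: "?c \<noteq> 0" "?C \<noteq> 0" by auto
    have s2: "?c^2 = 1 + ?s^2" "?C^2 = 1 + ?S^2" using cosh_square_eq by (auto simp: algebra_simps)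
    show "0 < ?s / (4 * ?c^2 * ?C^2)" using t by (simp add: \<open>?c > 0\<close> \<open>?C > 0\<close>)
    \<comment> \<open>Written as a difference, this argument lets the subtraction and double-angle
      formulas turn \<open>k t\<close> into a polynomial in sinh and cosh of t and q t.\<close>
    have "2 * (1 - q) * t = 2 * t - 2 * (q * t)" by (simp add: algebra_simps)
    then have "k t = (2*q - 1) * (2 * ?s * ?c)
        - (2 * ?s * ?c * (?C^2 + ?S^2) - (?c^2 + ?s^2) * (2 * ?S * ?C)) + 3 * (2 * ?S * ?C)"
      unfolding k_def by (simp only: sinh_diff sinh_double cosh_double mult.assoc)
    then have k_eq: "k t = 4 * (q * ?s * ?c - ?s * ?c * ?C^2 + ?S * ?C * (?c^2 + 1))"
      using s2 by algebra
    have "(\<psi> has_real_derivative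
       ?c / (1 + ?s^2) - (((1 - (tanh t)^2) - (1 - (tanh (q*t))^2) * q) * ?s^2 / ?c
         + (tanh t - tanh (q*t)) * ((2 * ?s * ?c * ?c - ?s^2 * ?s) / ?c^2))
         - (?c * ?c^2 - ?s * (2 * ?c * ?s)) / (?c^2)^2) (at t)"
      unfolding \<psi>_def
      by (rule derivative_eq_intros refl | simp add: nz)+
         (simp add: power2_eq_square field_simps nz)
    also have "?c / (1 + ?s^2) - (((1 - (tanh t)^2) - (1 - (tanh (q*t))^2) * q) * ?s^2 / ?c
         + (tanh t - tanh (q*t)) * ((2 * ?s * ?c * ?c - ?s^2 * ?s) / ?c^2))
         - (?c * ?c^2 - ?s * (2 * ?c * ?s)) / (?c^2)^2 = ?s / (4 * ?c^2 * ?C^2) * k t"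
      unfolding tanh_def k_eq s2(1)[symmetric] using X_gap_deriv_identity[OF nz s2] .
    finally show "(\<psi> has_real_derivative ?s / (4 * ?c^2 * ?C^2) * k t) (at t)" .
  qed
  show ?thesis
  proof (rule pos_if_deriv_stays_negative[OF _ _ _ \<open>stays_negative \<psi>\<close> _ t])
    show "(X_gap q \<longlongrightarrow> 0) (at_right 0)"
      unfolding X_gap_def[abs_def] using \<open>q > 0\<close> by real_asymp
    have lim1: "((\<lambda>t. ln (cosh (q*t)) / q - ln (cosh t)) \<longlongrightarrow> ln 2 - ln 2 / q) at_top"
      by (rule tendsto_ln_cosh_quotient[OF \<open>q > 0\<close>])
    have lim2: "((\<lambda>t::real. arctan (sinh t) / sinh t) \<longlongrightarrow> 0) at_top"
      by real_asymp
    have "(X_gap q \<longlongrightarrow> ln 2 - ln 2 / q - 0 + 1) at_top"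
      unfolding X_gap_def[abs_def]
      by (rule tendsto_add[OF tendsto_diff[OF lim1 lim2] tendsto_const])
    \<comment> \<open>The choice of q makes the limit at infinity vanish.\<close>
    moreover have "ln 2 / q = 1 + ln 2" using q \<open>q > 0\<close> by (simp add: field_simps)
    ultimately show "(X_gap q \<longlongrightarrow> 0) at_top" by simp
    fix t :: real assume t: "0 < t"
    let ?s = "sinh t" and ?c = "cosh t"
    have "?s > 0" "?c > 0" "cosh (q*t) > 0" using t by auto
    then have nz: "?s \<noteq> 0" "?c \<noteq> 0" "cosh (q*t) \<noteq> 0" by auto
    show "0 < ?c / ?s^2" using t by simp
    have d1: "((\<lambda>t. ln (cosh (q*t))) has_real_derivative sinh (q*t) * q / cosh (q*t)) (at t)"
      using nz(3) by (auto intro!: derivative_eq_intros)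
    have d2: "((\<lambda>t. ln (cosh t)) has_real_derivative ?s / ?c) (at t)"
      by (auto intro!: derivative_eq_intros)
    have d3: "((\<lambda>t. arctan (sinh t)) has_real_derivative ?c / (1 + ?s^2)) (at t)"
      by (auto intro!: derivative_eq_intros simp: field_simps)
    have d4: "(sinh has_real_derivative ?c) (at t)"
      by (auto intro!: derivative_eq_intros)
    have "(X_gap q has_real_derivative sinh (q*t) * q / cosh (q*t) / q - ?s / ?c
            - (?c / (1 + ?s^2) * ?s - arctan ?s * ?c) / (?s * ?s)) (at t)"
      unfolding X_gap_def[abs_def]
      by (rule DERIV_cong[OF DERIV_add[OF DERIV_diff[OF DERIV_diff[OF
            DERIV_cdivide[OF d1] d2] DERIV_divide[OF d3 d4 nz(1)]] DERIV_const]]) simp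
    also have "sinh (q*t) * q / cosh (q*t) / q - ?s / ?c
            - (?c / (1 + ?s^2) * ?s - arctan ?s * ?c) / (?s * ?s) = ?c / ?s^2 * \<psi> t"
      unfolding \<psi>_def tanh_def
      by (rule X_gap_deriv_identity') (use nz \<open>q > 0\<close> in \<open>auto simp: cosh_square_eq\<close>)
    finally show "(X_gap q has_real_derivative ?c / ?s^2 * \<psi> t) (at t)" .
  qed
qed

section \<open>Hyperbolic estimates and the inequality L + I < A + G\<close>

lemma sinh_less_mult_cosh:
  fixes t :: real assumes "0 < t" shows "sinh t < t * cosh t"
proof -
  have "0 < (\<lambda>t. t * cosh t - sinh t) t"
    by (rule pos_if_deriv_pos_at_right_0[OF _ assms, of _ "\<lambda>t. t * sinh t"])
       (auto intro!: tendsto_eq_intros derivative_eq_intros)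
  then show ?thesis by simp
qed

lemma one_less_cosh:
  fixes t :: real assumes "0 < t" shows "1 < cosh t"
  using cosh_real_nonneg_less_iff[of 0 t] assms by simp

lemma less_sinh:
  fixes t :: real assumes "0 < t" shows "t < sinh t"
proof -
  have "0 < (\<lambda>t. sinh t - t) t"
    by (rule pos_if_deriv_pos_at_right_0[OF _ assms, of _ "\<lambda>t. cosh t - 1"])
       (auto intro!: tendsto_eq_intros derivative_eq_intros simp: one_less_cosh)
  then show ?thesis by simp
qed

lemma cosh_gt_quadratic:
  fixes t :: real assumes "0 < t" shows "1 + t^2 / 2 < cosh t"
proof -
  have "0 < (\<lambda>t. cosh t - 1 - t^2 / 2) t"
    by (rule pos_if_deriv_pos_at_right_0[OF _ assms, of _ "\<lambda>t. sinh t - t"])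
       (auto intro!: tendsto_eq_intros derivative_eq_intros simp: less_sinh)
  then show ?thesis by simp
qed

text \<open>Divided by t^2, this is L^2 + L > 1 + cosh t. Differentiating four times leads to
  \<open>f4\<close>; the functions \<open>f0\<close> to \<open>f3\<close> vanish at 0, so positivity
  passes back from \<open>f4\<close> to \<open>f0\<close>.\<close>

lemma sinh_square_plus_gt:
  fixes t :: real assumes "0 < t"
  shows "t^2 * (1 + cosh t) < (sinh t)^2 + t * sinh t"
proof -
  define f0 where "f0 t = (sinh t)^2 + t * sinh t - t^2 - t^2 * cosh t" for t :: real
  define f1 where "f1 t = 2 * sinh t * cosh t + sinh t - t * cosh t - 2 * t - t^2 * sinh t" for t :: real
  define f2 where "f2 t = 4 * (sinh t)^2 - 3 * t * sinh t - t^2 * cosh t" for t :: real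
  define f3 where "f3 t = 8 * sinh t * cosh t - 3 * sinh t - 5 * t * cosh t - t^2 * sinh t" for t :: real
  define f4 where "f4 t = 16 * (cosh t)^2 - 8 * cosh t - 8 - 7 * t * sinh t - t^2 * cosh t" for t :: real
  have f4: "0 < f4 t" if t: "0 < t" for t
  proof -
    \<comment> \<open>With t^2 \<le> 2 (cosh t - 1), this bounds \<open>f4 t\<close> below by 8
      (cosh t - 1).\<close>
    have "t * sinh t < t * (t * cosh t)"
      using sinh_less_mult_cosh[OF t] t by simp
    moreover have "cosh t * (t^2 / 2) \<le> cosh t * (cosh t - 1)"
      using cosh_gt_quadratic[OF t] by (intro mult_left_mono) auto
    moreover have "1 < cosh t" using t by (simp add: one_less_cosh)
    ultimately show ?thesis unfolding f4_def by (simp add: power2_eq_square algebra_simps)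
  qed
  have f3: "0 < f3 t" if t: "0 < t" for t
  proof (rule pos_if_deriv_pos_at_right_0[OF _ t, of _ f4])
    show "(f3 has_real_derivative f4 y) (at y)" for y
      unfolding f3_def f4_def
      by (rule derivative_eq_intros refl | simp)+
         (use cosh_square_eq[of y] in algebra)
  qed (auto intro!: tendsto_eq_intros f4 simp: f3_def[abs_def])
  have f2: "0 < f2 t" if t: "0 < t" for t
  proof (rule pos_if_deriv_pos_at_right_0[OF _ t, of _ f3])
    show "(f2 has_real_derivative f3 y) (at y)" for y
      unfolding f2_def f3_def
      by (auto intro!: derivative_eq_intros simp: power2_eq_square algebra_simps)
  qed (auto intro!: tendsto_eq_intros f3 simp: f2_def[abs_def])
  have f1: "0 < f1 t" if t: "0 < t" for t
  proof (rule pos_if_deriv_pos_at_right_0[OF _ t, of _ f2])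
    show "(f1 has_real_derivative f2 y) (at y)" for y
      unfolding f1_def f2_def
      by (rule derivative_eq_intros refl | simp)+
         (use cosh_square_eq[of y] in algebra)
  qed (auto intro!: tendsto_eq_intros f2 simp: f1_def[abs_def])
  have "0 < f0 t"
  proof (rule pos_if_deriv_pos_at_right_0[OF _ assms, of _ f1])
    show "(f0 has_real_derivative f1 y) (at y)" for y
      unfolding f0_def f1_def
      by (auto intro!: derivative_eq_intros simp: power2_eq_square algebra_simps)
  qed (auto intro!: tendsto_eq_intros f1 simp: f0_def[abs_def])
  then show ?thesis unfolding f0_def by (simp add: algebra_simps)
qed

text \<open>The left side is the derivative of ln (A + G - L) - ln I, with \<open>s\<close> and
  \<open>c\<close> for sinh t and cosh t. The factorization reduces its sign to sinh t > t and the
  Wilker-type inequality.\<close>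

lemma log_plus_identric_deriv_identity:
  fixes s c t :: real
  assumes nz: "s \<noteq> 0" "t \<noteq> 0" "c + 1 - s/t \<noteq> 0" and sq: "c^2 = 1 + s^2"
  shows "(s - (c * t - s) / (t * t)) / (c + 1 - s/t) - ((c + t * s) * s - t * c * c) / (s * s)
       = (s - t) * (s^2 + t * s - t^2 * (1 + c)) / (t^2 * s^2 * (c + 1 - s/t))"
proof -
  define D where "D = c + 1 - s/t"
  have D: "t * D = t * (c + 1) - s" "D \<noteq> 0" using nz by (simp_all add: D_def field_simps)
  show ?thesis
    unfolding D_def[symmetric] using nz(1,2) D(2)
    by (simp add: divide_simps) (use D(1) sq in algebra)
qed

lemma log_plus_identric_less:
  fixes t :: real assumes t: "0 < t"
  shows "sinh t / t + exp (t * cosh t / sinh t - 1) < cosh t + 1"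
proof -
  define f where "f t = ln (cosh t + 1 - sinh t / t) - t * cosh t / sinh t + 1" for t :: real
  \<comment> \<open>L < A + G keeps the logarithm in \<open>f\<close> meaningful.\<close>
  have D: "0 < cosh t + 1 - sinh t / t" if "0 < t" for t :: real
    using sinh_less_mult_cosh[OF that] that by (simp add: field_simps add_pos_pos)
  have "0 < f t"
  proof (rule pos_if_deriv_pos_at_right_0[OF _ t])
    show "(f \<longlongrightarrow> 0) (at_right 0)" unfolding f_def[abs_def] by real_asymp
    fix t :: real assume t: "0 < t"
    let ?s = "sinh t" and ?c = "cosh t"
    let ?f' = "(?s - t) * (?s^2 + t * ?s - t^2 * (1 + ?c)) / (t^2 * ?s^2 * (?c + 1 - ?s/t))"
    show "0 < ?f'"
      using t D[OF t] less_sinh[OF t] sinh_square_plus_gt[OF t] by simp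
    have "(f has_real_derivative (?s - (?c * t - ?s) / (t * t)) / (?c + 1 - ?s/t)
              - ((?c + t * ?s) * ?s - t * ?c * ?c) / (?s * ?s)) (at t)"
      unfolding f_def
      by (rule derivative_eq_intros refl | use t D[OF t] in simp)+
    then show "(f has_real_derivative ?f') (at t)"
      using t D[OF t] by (subst (asm) log_plus_identric_deriv_identity) (auto simp: cosh_square_eq)
  qed
  then have "t * cosh t / sinh t - 1 < ln (cosh t + 1 - sinh t / t)" by (simp add: f_def)
  then have "exp (t * cosh t / sinh t - 1) < cosh t + 1 - sinh t / t"
    using D[OF t] by (metis exp_less_cancel_iff exp_ln)
  then show ?thesis by simp
qed

section \<open>The inequality M_q < (L + I)/2\<close>

lemma identric_exponent_lower:
  fixes t :: real assumes t: "0 < t"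
  shows "t^2 / 3 - t^4 / 45 < t * cosh t / sinh t - 1"
proof -
  \<comment> \<open>The bound is the Taylor polynomial of t coth t - 1 up to degree 4. Multiplying
    by sinh t clears the quotient; then g' = (t/45) h, and h' > 0 because sinh t < t cosh t.\<close>
  define g where "g t = t * cosh t - sinh t * (1 + t^2 / 3 - t^4 / 45)" for t :: real
  define h where "h t = sinh t * (15 + 4 * t^2) - cosh t * (15 * t - t^3)" for t :: real
  have h: "0 < h t" if "0 < t" for t
  proof (rule pos_if_deriv_pos_at_right_0[OF _ that, of _ "\<lambda>t. t * (7 * (t * cosh t - sinh t) + t^2 * sinh t)"])
    show "(h has_real_derivative y * (7 * (y * cosh y - sinh y) + y^2 * sinh y)) (at y)" for y
      unfolding h_def
      by (rule derivative_eq_intros refl | simp)+ (simp add: algebra_simps power2_eq_square power3_eq_cube)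
    show "0 < y * (7 * (y * cosh y - sinh y) + y^2 * sinh y)" if "0 < y" for y :: real
      using that sinh_less_mult_cosh[OF that] by (intro mult_pos_pos add_pos_pos) auto
  qed (auto intro!: tendsto_eq_intros simp: h_def[abs_def])
  have "0 < g t"
  proof (rule pos_if_deriv_pos_at_right_0[OF _ t, of _ "\<lambda>t. t / 45 * h t"])
    show "(g has_real_derivative y / 45 * h y) (at y)" for y
      unfolding g_def h_def
      by (rule derivative_eq_intros refl | simp)+ (simp add: field_simps power2_eq_square power3_eq_cube power4_eq_xxxx)
  qed (auto intro!: tendsto_eq_intros simp: g_def[abs_def] h)
  moreover have "0 < sinh t" using t by simp
  ultimately show ?thesis by (simp add: g_def field_simps)
qed

text \<open>The derivative of ln (sinh t / t) is (t coth t - 1)/t, so the previous bound is divided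
  by t and integrated from 0.\<close>

lemma ln_log_mean_lower:
  fixes t :: real assumes t: "0 < t"
  shows "t^2 / 6 - t^4 / 180 < ln (sinh t / t)"
proof -
  have "0 < (\<lambda>t::real. ln (sinh t / t) - (t^2 / 6 - t^4 / 180)) t"
  proof (rule pos_if_deriv_pos_at_right_0[OF _ t, of _ "\<lambda>t. (t * cosh t / sinh t - 1 - (t^2 / 3 - t^4 / 45)) / t"])
    show "((\<lambda>t::real. ln (sinh t / t) - (t^2 / 6 - t^4 / 180)) \<longlongrightarrow> 0) (at_right 0)" by real_asymp
    show "((\<lambda>t. ln (sinh t / t) - (t^2 / 6 - t^4 / 180)) has_real_derivative
          (y * cosh y / sinh y - 1 - (y^2 / 3 - y^4 / 45)) / y) (at y)" if "0 < y" for y :: real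
    proof -
      have "sinh y > 0" using that by simp
      then show ?thesis
        by (auto intro!: derivative_eq_intros simp: that)
           (use that in \<open>auto simp: field_simps power2_eq_square power3_eq_cube power4_eq_xxxx\<close>)
    qed
    show "0 < (y * cosh y / sinh y - 1 - (y^2 / 3 - y^4 / 45)) / y" if "0 < y" for y :: real
      using identric_exponent_lower[OF that] that by simp
  qed
  then show ?thesis by simp
qed

lemma ln_cosh_less:
  fixes z :: real assumes "0 < z" shows "ln (cosh z) < z^2 / 2"
proof -
  have "0 < (\<lambda>z. z^2 / 2 - ln (cosh z)) z"
  proof (rule pos_if_deriv_pos_at_right_0[OF _ assms, of _ "\<lambda>z. z - tanh z"])
    show "0 < y - tanh y" if "0 < y" for y :: real
      using sinh_less_mult_cosh[OF that] by (simp add: tanh_def field_simps)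
    show "((\<lambda>z. z^2 / 2 - ln (cosh z)) has_real_derivative y - tanh y) (at y)" for y :: real
      by (auto intro!: derivative_eq_intros simp: tanh_def)
    show "((\<lambda>z::real. z^2 / 2 - ln (cosh z)) \<longlongrightarrow> 0) (at_right 0)" by real_asymp
  qed
  then show ?thesis by simp
qed

lemma sum_le_exp:
  fixes x :: real assumes "0 \<le> x" shows "(\<Sum>n<N. x ^ n / fact n) \<le> exp x"
  using sum_le_suminf[OF summable_exp_generic[of x], of "{..<N}"] assms
  by (simp add: exp_def scaleR_conv_of_real field_simps)

lemma identric_exponent_gt:
  fixes t :: real assumes "0 < t" shows "t < t * cosh t / sinh t"
proof -
  have "sinh t < cosh t" by (simp add: sinh_def cosh_def)
  then show ?thesis using assms by (simp add: field_simps)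
qed

text \<open>Here ln M_q < q t^2/2 and ln L + ln I > t^2/2 - t^4/36, so M_q < sqrt (L I) follows from
  q + t^2/36 \<le> 1/2. At q = 7/17 and t = 7/4 the left side is about 0.497.\<close>

lemma cosh_powr_less_small:
  fixes q t :: real
  assumes q: "0 < q" "q \<le> 7/17" and t: "0 < t" "t \<le> 7/4"
  shows "cosh (q*t) powr (1/q) < (sinh t / t + exp (t * cosh t / sinh t - 1)) / 2"
proof -
  let ?L = "sinh t / t" and ?u = "t * cosh t / sinh t - 1"
  have L: "0 < ?L" using t by simp
  have "t^2 \<le> (7/4)^2" using t by (intro power_mono) auto
  then have "t^2 * (q + t^2 / 36) \<le> t^2 * (1/2)"
    using q by (intro mult_left_mono) (auto simp: power2_eq_square)
  moreover have "t^2 * (t^2 / 36) = t^4 / 36" by simp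
  ultimately have "t^2 * q \<le> t^2 / 2 - t^4 / 36" by (simp add: algebra_simps)
  also have "\<dots> < ln ?L + ?u"
    using ln_log_mean_lower[OF t(1)] identric_exponent_lower[OF t(1)] by simp
  finally have *: "t^2 * q < ln ?L + ?u" .
  have "ln (cosh (q*t)) / q < (q*t)^2 / 2 / q"
    using ln_cosh_less[of "q*t"] q t by (intro divide_strict_right_mono) auto
  also have "(q*t)^2 / 2 / q = t^2 * q / 2" using q by (simp add: power2_eq_square)
  also have "\<dots> < (ln ?L + ?u) / 2" using * by simp
  finally have "exp (ln (cosh (q*t)) / q) < exp ((ln ?L + ?u) / 2)" by simp
  also have "exp ((ln ?L + ?u) / 2) = sqrt (?L * exp ?u)"
  proof (rule real_sqrt_unique[symmetric])
    have "(exp ((ln ?L + ?u) / 2))^2 = exp (ln ?L + ?u)" by (simp flip: exp_double)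
    then show "(exp ((ln ?L + ?u) / 2))^2 = ?L * exp ?u" unfolding exp_add using L by simp
  qed simp
  also have "\<dots> \<le> (?L + exp ?u) / 2"
    using L by (intro arith_geo_mean_sqrt) auto
  finally show ?thesis using q by (simp add: powr_def)
qed

lemma exp_1_ge: "271/100 \<le> exp (1::real)"
  using sum_le_exp[of 1 6] by (simp add: lessThan_nat_numeral fact_numeral)

text \<open>Since 2^(1/q) = 2e, M_q equals (1 + z)^(1/q) e^t / (2e). With I replaced by the smaller
  e^(t-1), the claim becomes (1 + z)^(1/q) < 1 + (e - e^(1-2t))/(2t); the bounds z \<le> w and 1/q
  \<le> 5/2 remove q.\<close>

lemma cosh_powr_less_large:
  fixes q t :: real
  assumes q: "q = ln 2 / (1 + ln 2)" "2/5 \<le> q" and t: "7/4 \<le> t"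
  shows "cosh (q*t) powr (1/q) < (sinh t / t + exp (t * cosh t / sinh t - 1)) / 2"
proof -
  define z where "z = exp (- (2 * q * t))"
  define w where "w = exp (- (4/5 * t))"
  have "4/5 * t \<le> 2 * q * t" using q(2) t by (intro mult_right_mono) auto
  then have z: "0 < z" "z \<le> w" unfolding z_def w_def by auto
  then have w0: "0 < w" by simp
  have e14: "405/100 \<le> exp (7/5::real)"
    using sum_le_exp[of "7/5" 7] by (simp add: lessThan_nat_numeral fact_numeral power_divide)
  have e25: "114/10 \<le> exp (5/2::real)"
    using sum_le_exp[of "5/2" 6] by (simp add: lessThan_nat_numeral fact_numeral power_divide)
  \<comment> \<open>This is the tangent line of exp at 7/5, the value of 4t/5 at t = 7/4. From there
    on, 4t/5 - 2/5 \<ge> 4t/7, which bounds t w by a constant.\<close>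
  have "405/100 * (4/5 * t - 2/5) \<le> exp (7/5) * exp (4/5 * t - 7/5)"
    using e14 t exp_ge_add_one_self[of "4/5 * t - 7/5"] by (intro mult_mono) auto
  also have "\<dots> = 1 / w" by (simp add: w_def exp_minus field_simps flip: exp_add)
  finally have "405/100 * (4/7 * t) \<le> 1 / w" using t by simp
  then have tw: "2 * t * w \<le> 350/405" using w0 by (simp add: field_simps)
  moreover have "(7/2) * w \<le> 2 * t * w" using t w0 by (intro mult_right_mono) auto
  ultimately have w: "w \<le> 100/405" by simp
  \<comment> \<open>The bracket comes from (1 + w)^2 (1 + w/2) - 1 = w (5/2 + 2w + w^2/2).
    Numerically, 2.62 + 10/114 < 2.71.\<close>
  have "2 * t * w * (5/2 + 2 * w + w^2 / 2) \<le> 350/405 * (5/2 + 2 * (100/405) + (100/405)^2 / 2)"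
    using tw w w0 t by (intro mult_mono add_mono divide_right_mono power_mono) auto
  also have "350/405 * (5/2 + 2 * (100/405) + (100/405)^2 / 2) \<le> (262/100 :: real)"
    by (simp add: power2_eq_square)
  finally have "2 * t * w * (5/2 + 2 * w + w^2 / 2) \<le> 262/100" .
  moreover have "exp (1 - 2 * t) \<le> exp (- (5/2))" using t by simp
  moreover have "exp (- (5/2)) \<le> 10/(114::real)"
    using e25 by (simp add: exp_minus field_simps)
  ultimately have "2 * t * w * (5/2 + 2 * w + w^2 / 2) + exp (1 - 2 * t) < exp 1"
    using exp_1_ge by linarith
  then have "2 * t * ((1 + w)^2 * (1 + w/2) - 1) < exp 1 - exp (1 - 2*t)"
    by (simp add: power2_eq_square algebra_simps)
  then have key: "(1 + w)^2 * (1 + w/2) < 1 + (exp 1 - exp (1 - 2*t)) / (2*t)"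
    using t by (simp add: field_simps)
  have "(1 + z) powr (1/q) \<le> (1 + w) powr (1/q)"
    using z q by (intro powr_mono2) auto
  also have "\<dots> \<le> (1 + w) powr (5/2)"
    using w0 divide_left_mono[of "2/5" q 1] q(2) by (intro powr_mono) auto
  \<comment> \<open>Splitting off the square leaves a square root, for which Bernoulli's inequality
    gives 1 + w/2.\<close>
  also have "(1 + w) powr (5/2) = (1 + w) powr (of_nat 2 + 1/2)" by simp
  also have "\<dots> = (1 + w)^2 * sqrt (1 + w)"
    using w0 by (subst powr_add, subst powr_realpow) (auto simp: powr_half_sqrt)
  also have "\<dots> \<le> (1 + w)^2 * (1 + w/2)"
    using w0 by (intro mult_left_mono real_le_lsqrt) (auto simp: power2_eq_square algebra_simps)
  also note key
  finally have *: "(1 + z) powr (1/q) < 1 + (exp 1 - exp (1 - 2*t)) / (2*t)" .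
  have "q > 0" using q(2) by linarith
  then have lnq: "ln 2 / q = 1 + ln 2" using q(1) by (simp add: field_simps)
  have "cosh (q*t) = (1 + z) * exp (q*t) / 2"
    by (simp add: cosh_def z_def algebra_simps flip: exp_add)
  then have "cosh (q*t) powr (1/q) = ((1 + z) * exp (q*t) / 2) powr (1/q)" by (rule arg_cong)
  also have "\<dots> = (1 + z) powr (1/q) * exp (q*t) powr (1/q) / 2 powr (1/q)"
    using z by (simp add: powr_mult powr_divide)
  also have "exp (q*t) powr (1/q) = exp t" using \<open>q > 0\<close> by (simp add: powr_def)
  also have "2 powr (1/q) = 2 * exp (1::real)"
    using lnq by (simp add: powr_def exp_add)
  also have "(1 + z) powr (1/q) * exp t / (2 * exp 1)
      < (1 + (exp 1 - exp (1 - 2*t)) / (2*t)) * exp t / (2 * exp 1)"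
    using * by (intro divide_strict_right_mono mult_strict_right_mono) auto
  also have "\<dots> = (sinh t / t + exp (t - 1)) / 2"
  proof -
    have "exp 1 - exp (1 - 2*t) = exp (1 - t) * (exp t - exp (- t))"
      by (simp add: algebra_simps flip: exp_add)
    then have "exp 1 - exp (1 - 2*t) = 2 * exp 1 * sinh t / exp t"
      by (simp add: sinh_def exp_diff)
    then show ?thesis using t by (simp add: field_simps exp_diff)
  qed
  also have "\<dots> < (sinh t / t + exp (t * cosh t / sinh t - 1)) / 2"
    using identric_exponent_gt[of t] t by simp
  finally show ?thesis .
qed

section \<open>The means for a = m e^t, b = m e^(-t), and their symmetry\<close>

lemma means_exp:
  fixes m t :: real
  assumes m: "0 < m" and t: "0 < t"
  shows arith_mean_exp: "arith_mean (m * exp t) (m * exp (-t)) = m * cosh t"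
    and geom_mean_exp: "geom_mean (m * exp t) (m * exp (-t)) = m"
    and log_mean_exp: "log_mean (m * exp t) (m * exp (-t)) = m * (sinh t / t)"
    and identric_mean_exp:
      "identric_mean (m * exp t) (m * exp (-t)) = m * exp (t * cosh t / sinh t - 1)"
    and X_mean_exp:
      "X_mean (m * exp t) (m * exp (-t)) = m * (cosh t * exp (arctan (sinh t) / sinh t - 1))"
proof -
  let ?a = "m * exp t" and ?b = "m * exp (-t)"
  have ab: "?a - ?b = 2 * m * sinh t" "?a + ?b = 2 * m * cosh t"
    by (simp_all add: sinh_def cosh_def algebra_simps)
  have s: "0 < sinh t" using t by simp
  show A: "arith_mean ?a ?b = m * cosh t" unfolding arith_mean_def ab by simp
  have "?a * ?b = m^2" by (simp add: power2_eq_square exp_minus)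
  then show G: "geom_mean ?a ?b = m" unfolding geom_mean_def using m by simp
  have ln: "ln ?a = ln m + t" "ln ?b = ln m - t" using m by (simp_all add: ln_mult)
  show "log_mean ?a ?b = m * (sinh t / t)"
    unfolding log_mean_def ab ln using t by simp
  have "?a powr ?a / ?b powr ?b = exp (?a * (ln m + t) - ?b * (ln m - t))"
    using m ln by (simp add: powr_def exp_diff)
  also have "?a * (ln m + t) - ?b * (ln m - t) = (?a - ?b) * ln m + (?a + ?b) * t"
    by (simp add: algebra_simps)
  also have "\<dots> = 2 * m * (sinh t * ln m + cosh t * t)" unfolding ab by (simp add: algebra_simps)
  finally have "(?a powr ?a / ?b powr ?b) powr (1 / (?a - ?b))
      = exp (2 * m * (sinh t * ln m + cosh t * t) / (2 * m * sinh t))"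
    unfolding ab by (simp add: powr_def)
  also have "2 * m * (sinh t * ln m + cosh t * t) / (2 * m * sinh t) = ln m + t * cosh t / sinh t"
    using m s by (simp add: field_simps)
  finally show "identric_mean ?a ?b = m * exp (t * cosh t / sinh t - 1)"
    unfolding identric_mean_def using m by (simp add: exp_add exp_diff)
  have "(?a - ?b) / (?a + ?b) = tanh t" unfolding ab tanh_def using m by simp
  \<comment> \<open>This replaces the arcsine in P by a function of t whose derivative is 1 / cosh
    t.\<close>
  moreover have "arcsin (tanh t) = arctan (sinh t)"
  proof (rule arcsin_unique)
    show "- pi/2 \<le> arctan (sinh t)" "arctan (sinh t) \<le> pi/2"
      using arctan_bounded[of "sinh t"] by (auto simp: less_imp_le)
    have "sqrt (1 + (sinh t)^2) = cosh t"
      by (rule real_sqrt_unique) (auto simp: cosh_square_eq)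
    then show "sin (arctan (sinh t)) = tanh t" by (simp add: sin_arctan tanh_def)
  qed
  ultimately have P: "seiffert_mean ?a ?b = m * sinh t / arctan (sinh t)"
    unfolding seiffert_mean_def ab by simp
  show "X_mean ?a ?b = m * (cosh t * exp (arctan (sinh t) / sinh t - 1))"
    unfolding X_mean_def A G P using m by simp
qed

lemma power_mean_exp:
  fixes m t p :: real
  assumes m: "0 < m" and p: "p \<noteq> 0"
  shows "power_mean p (m * exp t) (m * exp (-t)) = m * cosh (p*t) powr (1/p)"
proof -
  have "((m * exp t) powr p + (m * exp (-t)) powr p) / 2 = m powr p * cosh (p*t)"
    using m by (simp add: powr_mult cosh_def exp_powr_real algebra_simps add_divide_distrib)
  then have "power_mean p (m * exp t) (m * exp (-t)) = (m powr p * cosh (p*t)) powr (1/p)"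
    unfolding power_mean_def using p by simp
  also have "\<dots> = m * cosh (p*t) powr (1/p)"
    using m p by (simp add: powr_mult powr_powr)
  finally show ?thesis .
qed

text \<open>Reduces the theorem to b < a. For P, positivity places (a - b)/(a + b) in [-1, 1], where
  arcsin is odd.\<close>

lemma means_commute:
  shows arith_mean_commute: "arith_mean a b = arith_mean b a"
    and geom_mean_commute: "geom_mean a b = geom_mean b a"
    and log_mean_commute: "log_mean a b = log_mean b a"
    and power_mean_commute: "power_mean p a b = power_mean p b a"
    and X_mean_commute: "\<lbrakk>0 < a; 0 < b\<rbrakk> \<Longrightarrow> X_mean a b = X_mean b a"
    and identric_mean_commute: "\<lbrakk>0 < a; 0 < b\<rbrakk> \<Longrightarrow> identric_mean a b = identric_mean b a"
proof -
  show A: "arith_mean a b = arith_mean b a" by (simp add: arith_mean_def add.commute)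
  show G: "geom_mean a b = geom_mean b a" by (simp add: geom_mean_def mult.commute)
  show "log_mean a b = log_mean b a"
    unfolding log_mean_def by (metis minus_diff_eq minus_divide_divide)
  show "power_mean p a b = power_mean p b a" by (simp add: power_mean_def ac_simps)
  {
    assume ab: "0 < a" "0 < b"
    have "- 1 \<le> (a - b) / (a + b)" "(a - b) / (a + b) \<le> 1" using ab by (simp_all add: field_simps)
    moreover have "(b - a) / (b + a) = - ((a - b) / (a + b))" by (simp add: add.commute divide_simps)
    ultimately have "arcsin ((b - a) / (b + a)) = - arcsin ((a - b) / (a + b))"
      using arcsin_minus[of "(a - b) / (a + b)"] by simp
    then have "seiffert_mean a b = seiffert_mean b a"
      unfolding seiffert_mean_def by (simp add: divide_simps)
    then show "X_mean a b = X_mean b a" unfolding X_mean_def by (simp add: A G)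
    have "((b powr b) / (a powr a)) = inverse ((a powr a) / (b powr b))" by simp
    then have "((b powr b) / (a powr a)) powr (1 / (b - a))
        = ((a powr a) / (b powr b)) powr (- (1 / (b - a)))"
      using ab by (simp add: powr_minus powr_divide inverse_eq_divide)
    moreover have "- (1 / (b - a)) = 1 / (a - b)" by (simp add: divide_simps)
    ultimately show "identric_mean a b = identric_mean b a" unfolding identric_mean_def by simp
  }
qed

section \<open>The inequality (A + G)/e < X\<close>

lemma ln_less_arctan_sinh_quotient:
  fixes t :: real assumes t: "0 < t" shows "ln (1 + 1 / cosh t) < arctan (sinh t) / sinh t"
proof -
  have s: "0 < sinh t" using t by simp
  \<comment> \<open>In terms of means, 1 + 1/cosh t is (A + G)/A and the right side is G/P. As ln (1
    + x) \<le> x at x = 1/cosh t, it is enough that tanh t < arctan (sinh t).\<close>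
  have "0 < (\<lambda>t. arctan (sinh t) - tanh t) t"
  proof (rule pos_if_deriv_pos_at_right_0[OF _ t])
    show "((\<lambda>t::real. arctan (sinh t) - tanh t) \<longlongrightarrow> 0) (at_right 0)"
      by (auto intro!: tendsto_eq_intros)
    show "((\<lambda>t. arctan (sinh t) - tanh t) has_real_derivative (cosh y - 1) / (cosh y)^2) (at y)" for y :: real
    proof -
      have "((\<lambda>t. arctan (sinh t) - tanh t) has_real_derivative
          cosh y / (cosh y)^2 - (1 - (tanh y)^2)) (at y)"
        by (auto intro!: derivative_eq_intros simp: cosh_square_eq field_simps)
      also have "1 - (tanh y)^2 = 1 / (cosh y)^2"
        by (simp add: tanh_def power_divide sinh_square_eq diff_divide_distrib)
      finally show ?thesis by (simp add: diff_divide_distrib)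
    qed
    show "0 < (cosh y - 1) / (cosh y)^2" if "0 < y" for y :: real
      using one_less_cosh[OF that] by simp
  qed
  then have "1 / cosh t < arctan (sinh t) / sinh t" using s by (simp add: tanh_def field_simps)
  moreover have "ln (1 + 1 / cosh t) \<le> 1 / cosh t" by (intro ln_add_one_self_le_self) simp
  ultimately show ?thesis by simp
qed

section \<open>The chain of inequalities and the optimality of q\<close>

theorem theorem2p8:
  fixes q :: real
  assumes q_eq: "q = ln 2 / (1 + ln 2)"
  shows "(\<forall>a b :: real. a > 0 \<longrightarrow> b > 0 \<longrightarrow> a \<noteq> b \<longrightarrow>
            (arith_mean a b + geom_mean a b) / exp 1 < X_mean a b \<and>
            X_mean a b < power_mean q a b \<and>
            power_mean q a b < (log_mean a b + identric_mean a b) / 2 \<and>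
            (log_mean a b + identric_mean a b) / 2 < (arith_mean a b + geom_mean a b) / 2)
       \<and> (\<forall>r < q. \<not> (\<forall>a b :: real. a > 0 \<longrightarrow> b > 0 \<longrightarrow> a \<noteq> b \<longrightarrow>
            X_mean a b < power_mean r a b))
       \<and> (\<forall>r > q. \<not> (\<forall>a b :: real. a > 0 \<longrightarrow> b > 0 \<longrightarrow> a \<noteq> b \<longrightarrow>
            power_mean r a b < (log_mean a b + identric_mean a b) / 2))"
proof -
  have "0 < ln (2::real)" by simp
  \<comment> \<open>q increases with ln 2: the bound ln 2 \<ge> 2/3 gives 2/5, and ln 2 \<le> 25/36
    gives 25/61 < 7/17.\<close>
  then have q: "2/5 \<le> q" "q \<le> 7/17"
    using ln2_ge_two_thirds ln2_le_25_over_36 by (simp_all add: q_eq field_simps)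
  then have q0: "0 < q" by simp
  then have lnq: "ln 2 / q = 1 + ln 2" using q_eq by (simp add: field_simps)
  have chain: "(arith_mean a b + geom_mean a b) / exp 1 < X_mean a b \<and>
      X_mean a b < power_mean q a b \<and>
      power_mean q a b < (log_mean a b + identric_mean a b) / 2 \<and>
      (log_mean a b + identric_mean a b) / 2 < (arith_mean a b + geom_mean a b) / 2"
    if ab: "b < a" "0 < b" for a b :: real
  proof -
    define m where "m = sqrt (a * b)"
    define t where "t = ln (a / b) / 2"
    have t: "0 < t" using ab by (simp add: t_def)
    have m: "0 < m" using ab by (simp add: m_def)
    have "exp (ln a) = exp (ln m + t)" "exp (ln b) = exp (ln m - t)"
      using ab by (auto simp: m_def t_def ln_sqrt ln_mult ln_div field_simps)
    then have ab_eq: "a = m * exp t" "b = m * exp (-t)"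
      using ab m by (simp_all add: exp_add exp_diff exp_minus field_simps)
    have scale: "m * x < (m * y + m * z) / 2" if "x < (y + z) / 2" for x y z
      using mult_strict_left_mono[OF that m] by (simp add: field_simps)
    have scale': "(m * y + m * z) / 2 < (m * u + m) / 2" if "y + z < u + 1" for y z u
      using mult_strict_left_mono[OF that m] by (simp add: field_simps)
    have "(m * cosh t + m) / exp 1 < m * (cosh t * exp (arctan (sinh t) / sinh t - 1))"
    proof -
      have "exp (ln (1 + 1 / cosh t)) < exp (arctan (sinh t) / sinh t)"
        using ln_less_arctan_sinh_quotient[OF t] by simp
      moreover have "exp (ln (1 + 1 / cosh t)) = 1 + 1 / cosh t"
        by (simp add: add_pos_pos)
      ultimately have "m * cosh t * (1 + 1 / cosh t) / exp 1 < m * cosh t * exp (arctan (sinh t) / sinh t) / exp 1"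
        using m by (intro divide_strict_right_mono mult_strict_left_mono) auto
      moreover have "m * cosh t * (1 + 1 / cosh t) = m * cosh t + m"
        by (simp add: field_simps)
      ultimately show ?thesis by (simp add: exp_diff mult.assoc)
    qed
    moreover have "cosh t * exp (arctan (sinh t) / sinh t - 1) < cosh (q*t) powr (1/q)"
    proof -
      have "exp (ln (cosh t) + (arctan (sinh t) / sinh t - 1)) < exp (ln (cosh (q*t)) / q)"
        using X_gap_pos[OF q_eq q t] by (simp add: X_gap_def)
      then show ?thesis unfolding exp_add by (simp add: powr_def)
    qed
    moreover have "cosh (q*t) powr (1/q) < (sinh t / t + exp (t * cosh t / sinh t - 1)) / 2"
      using cosh_powr_less_small[OF q0 q(2) t] cosh_powr_less_large[OF q_eq q(1)] by (cases "t \<le> 7/4") auto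
    ultimately show ?thesis
      unfolding ab_eq means_exp[OF m t] power_mean_exp[OF m less_imp_neq[OF q0, symmetric]]
      by (intro conjI scale scale' log_plus_identric_less[OF t]) (use m in simp_all)
  qed
  have "\<not> (\<forall>a b :: real. a > 0 \<longrightarrow> b > 0 \<longrightarrow> a \<noteq> b \<longrightarrow> X_mean a b < power_mean r a b)"
    if "r < q" for r
  proof
    assume *: "\<forall>a b :: real. a > 0 \<longrightarrow> b > 0 \<longrightarrow> a \<noteq> b \<longrightarrow> X_mean a b < power_mean r a b"
    \<comment> \<open>Dropping the positive term G/P from the exponent of X leaves A/e.\<close>
    have less: "cosh t / exp 1 < power_mean r (exp t) (exp (-t))" if t: "0 < t" for t :: real
    proof -
      have "0 < arctan (sinh t) / sinh t" using t by simp
      then have "cosh t * exp (-1) < X_mean (exp t) (exp (-t))"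
        using X_mean_exp[of 1 t] t by simp
      also have "\<dots> < power_mean r (exp t) (exp (-t))" using * t by simp
      finally show ?thesis by (simp add: exp_minus field_simps)
    qed
    show False
    proof (cases "0 < r")
      case False
      \<comment> \<open>For r \<le> 0, M_r \<le> G = 1, so one large t refutes the bound; t = 4
        works because cosh 4 > 9 > e.\<close>
      have "power_mean r (exp 4) (exp (-4)) \<le> 1"
      proof (cases "r = 0")
        case True
        then show ?thesis by (simp add: power_mean_def flip: exp_add)
      next
        case neq: False
        have "cosh (r*4) powr (1/r) \<le> cosh (r*4) powr 0"
          using False cosh_real_ge_1[of "r*4"] by (intro powr_mono) auto
        then show ?thesis using power_mean_exp[of 1 r 4] neq by simp
      qed
      moreover have "exp 1 \<le> cosh (4::real)"
        using cosh_gt_quadratic[of 4] exp_le by simp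
      then have "1 \<le> cosh 4 / exp (1::real)" by simp
      ultimately show False using less[of 4] by linarith
    next
      case True
      \<comment> \<open>The bound M_r/A > 1/e in the limit gives ln 2 - (ln 2)/r \<ge> -1, that is r
        \<ge> q.\<close>
      have "eventually (\<lambda>t. -1 \<le> ln (cosh (r*t)) / r - ln (cosh t)) at_top"
        using eventually_gt_at_top[of 0]
      proof eventually_elim
        case (elim t)
        have "exp (ln (cosh t) - 1) < exp (ln (cosh (r*t)) / r)"
          using less[OF elim] power_mean_exp[of 1 r t] True by (simp add: powr_def exp_diff)
        then show ?case by simp
      qed
      then have "-1 \<le> ln 2 - ln 2 / r"
        using tendsto_lowerbound[OF tendsto_ln_cosh_quotient[OF True]] by simp
      then have "ln 2 / r \<le> ln 2 / q" using lnq by simp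
      then have "q \<le> r" using True q0 by (simp add: field_simps)
      with \<open>r < q\<close> show False by simp
    qed
  qed
  moreover have "\<not> (\<forall>a b :: real. a > 0 \<longrightarrow> b > 0 \<longrightarrow> a \<noteq> b \<longrightarrow>
      power_mean r a b < (log_mean a b + identric_mean a b) / 2)" if "q < r" for r
  proof
    assume *: "\<forall>a b :: real. a > 0 \<longrightarrow> b > 0 \<longrightarrow> a \<noteq> b \<longrightarrow>
      power_mean r a b < (log_mean a b + identric_mean a b) / 2"
    have r: "0 < r" using that q0 by simp
    \<comment> \<open>\<open>?M\<close> is (L + I)/2 divided by A. Since L/A tends to 0 and I/A to
      2/e, its limit is 1/e; comparison with the limit of M_r/A forces r \<le> q.\<close>
    let ?M = "\<lambda>t::real. (sinh t / t + exp (t * cosh t / sinh t - 1)) / 2 / cosh t"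
    have "eventually (\<lambda>t. exp (ln (cosh (r*t)) / r - ln (cosh t)) \<le> ?M t) at_top"
      using eventually_gt_at_top[of 0]
    proof eventually_elim
      case (elim t)
      have "cosh (r*t) powr (1/r) < (sinh t / t + exp (t * cosh t / sinh t - 1)) / 2"
        using *[rule_format, of "exp t" "exp (-t)"] power_mean_exp[of 1 r t] r elim
          log_mean_exp[of 1 t] identric_mean_exp[of 1 t] by simp
      then have "cosh (r*t) powr (1/r) / cosh t \<le> ?M t"
        by (intro divide_right_mono) auto
      then show ?case by (simp add: powr_def exp_diff)
    qed
    moreover have "(?M \<longlongrightarrow> exp (-1)) at_top" by real_asymp
    moreover have "((\<lambda>t. exp (ln (cosh (r*t)) / r - ln (cosh t))) \<longlongrightarrow> exp (ln 2 - ln 2 / r)) at_top"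
      by (intro tendsto_exp tendsto_ln_cosh_quotient r)
    ultimately have "exp (ln 2 - ln 2 / r) \<le> exp (-1)"
      by (intro tendsto_le[of at_top ?M _ "\<lambda>t. exp (ln (cosh (r*t)) / r - ln (cosh t))"]) auto
    then have "ln 2 / q \<le> ln 2 / r" using lnq by simp
    then have "r \<le> q" using r q0 by (simp add: field_simps)
    with that show False by simp
  qed
  moreover have "(arith_mean a b + geom_mean a b) / exp 1 < X_mean a b \<and>
      X_mean a b < power_mean q a b \<and>
      power_mean q a b < (log_mean a b + identric_mean a b) / 2 \<and>
      (log_mean a b + identric_mean a b) / 2 < (arith_mean a b + geom_mean a b) / 2"
    if "0 < a" "0 < b" "a \<noteq> b" for a b :: real
  proof (cases "b < a")
    case True
    then show ?thesis using chain that by blast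
  next
    case False
    then show ?thesis
      using chain[of a b] that arith_mean_commute[of a b] geom_mean_commute[of a b]
        log_mean_commute[of a b] power_mean_commute[of q a b]
        X_mean_commute[of a b] identric_mean_commute[of a b] by simp
  qed
  ultimately show ?thesis by blast
qed

end
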